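(* For every integer $n\ge 4$, the maximum fractional forcing number of the hypercube $Q_n$ satisfies $F_f(Q_n)\le\frac{n2^{n-1}-5\cdot 2^{n-3}}{n}$.
   Context: The hypercube graph $Q_n$ has vertex set $\{0,1\}^n$, two vertices being adjacent iff they differ in exactly one coordinate. For a finite simple graph $G$, a fractional matching is a function $\alpha:E(G)\to\mathbb{R}^{\ge 0}$ with $\sum_{e\ni v}\alpha(e)\le 1$ for every $v\in V(G)$; it is a fractional perfect matching if equality holds at every $v$. $\mathcal{P}_f(G)$ denotes the set of all fractional perfect matchings of $G$. Write $\|\alpha\|_1=\sum_{e\in E(G)}|\alpha(e)|$, and $\alpha\preceq\gamma$ if $\alpha(e)\le\gamma(e)$ for all $e\in E(G)$. For a fractional matching $\alpha$ and $\gamma\in\mathcal{P}_f(G)$, write $\alpha\uparrow\gamma$ if $\alpha\preceq\gamma$ and $\gamma$ is the only element $\gamma'$ of $\mathcal{P}_f(G)$ with $\alpha\preceq\gamma'$. The fractional forcing number of $\gamma$ is $f_G(\gamma)=\inf\{\|\alpha\|_1:\alpha\uparrow\gamma\}$, and the maximum fractional forcing number of $G$ is $F_f(G)=\sup_{\gamma\in\mathcal{P}_f(G)}f_G(\gamma)$. *)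

theory Defs
  imports Complex_Main "HOL-Library.FuncSet"
begin

text \<open>A graph is a pair of its vertex set and its edge set, an edge being a two-element set of
  vertices.\<close>

type_synonym 'a graph = "'a set \<times> 'a set set"

abbreviation verts :: "'a graph \<Rightarrow> 'a set" where "verts G \<equiv> fst G"
abbreviation edges :: "'a graph \<Rightarrow> 'a set set" where "edges G \<equiv> snd G"

definition finite_simple_graph :: "'a graph \<Rightarrow> bool" where
  "finite_simple_graph G \<longleftrightarrow>
     finite (verts G) \<and> (\<forall>e\<in>edges G. e \<subseteq> verts G \<and> card e = 2)"

definition hypercube :: "nat \<Rightarrow> bool list graph" where
  "hypercube n =
     (let V = {u :: bool list. length u = n}
      in (V, {{u, v} | u v. u \<in> V \<and> v \<in> V \<and> card {i. i < n \<and> u ! i \<noteq> v ! i} = 1}))"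

text \<open>Weight functions have domain exactly the edge set: by extensionality they take the value
  \<open>undefined\<close> on non-edges, so that equality of weight functions is equality on the edges.\<close>

definition fractional_matchings :: "'a graph \<Rightarrow> ('a set \<Rightarrow> real) set" where
  "fractional_matchings G =
     {\<alpha> \<in> edges G \<rightarrow>\<^sub>E {0..}. \<forall>v\<in>verts G. (\<Sum>e | e \<in> edges G \<and> v \<in> e. \<alpha> e) \<le> 1}"

definition fractional_perfect_matchings :: "'a graph \<Rightarrow> ('a set \<Rightarrow> real) set" where
  "fractional_perfect_matchings G =
     {\<alpha> \<in> fractional_matchings G. \<forall>v\<in>verts G. (\<Sum>e | e \<in> edges G \<and> v \<in> e. \<alpha> e) = 1}"

definition l1_norm :: "'a graph \<Rightarrow> ('a set \<Rightarrow> real) \<Rightarrow> real" where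
  "l1_norm G \<alpha> = (\<Sum>e\<in>edges G. \<bar>\<alpha> e\<bar>)"

definition edge_le :: "'a graph \<Rightarrow> ('a set \<Rightarrow> real) \<Rightarrow> ('a set \<Rightarrow> real) \<Rightarrow> bool" where
  "edge_le G \<alpha> \<gamma> \<longleftrightarrow> (\<forall>e\<in>edges G. \<alpha> e \<le> \<gamma> e)"

definition forces :: "'a graph \<Rightarrow> ('a set \<Rightarrow> real) \<Rightarrow> ('a set \<Rightarrow> real) \<Rightarrow> bool" where
  "forces G \<alpha> \<gamma> \<longleftrightarrow>
     \<alpha> \<in> fractional_matchings G \<and> \<gamma> \<in> fractional_perfect_matchings G \<and> edge_le G \<alpha> \<gamma> \<and>
     (\<forall>\<gamma>'\<in>fractional_perfect_matchings G. edge_le G \<alpha> \<gamma>' \<longrightarrow> \<gamma>' = \<gamma>)"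

text \<open>On the reals, \<open>Inf\<close> and \<open>Sup\<close> are meaningful only for nonempty sets that are bounded below,
  respectively above.  For a fractional perfect matching \<open>\<gamma>\<close> of a finite simple graph the infimum
  is over a nonempty set (\<open>\<gamma>\<close> forces itself) of nonnegative reals.  The supremum is over values
  bounded by half the number of vertices, and is meaningful as soon as the graph has a fractional
  perfect matching, as the hypercube of positive dimension does.\<close>

definition fractional_forcing_number :: "'a graph \<Rightarrow> ('a set \<Rightarrow> real) \<Rightarrow> real" where
  "fractional_forcing_number G \<gamma> = Inf {l1_norm G \<alpha> | \<alpha>. forces G \<alpha> \<gamma>}"

definition max_fractional_forcing_number :: "'a graph \<Rightarrow> real" where
  "max_fractional_forcing_number G =
     (SUP \<gamma>\<in>fractional_perfect_matchings G. fractional_forcing_number G \<gamma>)"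

lemma finite_simple_graph_hypercube: "finite_simple_graph (hypercube n)"
proof -
  have "finite {u :: bool list. length u = n}"
    using finite_lists_length_eq[of "UNIV :: bool set" n] by simp
  moreover have "card {u, v} = 2"
    if "card {i. i < n \<and> u ! i \<noteq> v ! i} = 1" for u v :: "bool list"
  proof -
    have "u \<noteq> v" using that by auto
    then show ?thesis by simp
  qed
  ultimately show ?thesis
    by (auto simp: finite_simple_graph_def hypercube_def Let_def)
qed

end

theory Submission
  imports Defs
begin

text \<open>
  Lowering a fractional perfect matching \<open>\<gamma>\<close> to zero on a set \<open>S\<close> of edges and keeping it elsewhere
  still forces \<open>\<gamma>\<close> if no nonzero edge function with zero sum at every vertex is nonnegative off
  \<open>S\<close>.  Linear programming duality suggests how to certify this: a weight \<open>y\<close> on the vertices with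
  \<open>y u + y v \<ge> 0\<close> on every edge, tight exactly on \<open>S\<close>.  Pairing such an edge function with \<open>y\<close>
  gives zero, so it must vanish off \<open>S\<close>; and if \<open>S\<close> is a forest it vanishes on \<open>S\<close> as well.  Here
  the forests are disjoint unions of stars.  This is \<open>potential_forces\<close>; the forcing number is
  thus at most half the number of vertices minus the weight of \<open>\<gamma>\<close> on \<open>S\<close>.

  Nothing is known about how \<open>\<gamma>\<close> distributes its weight, so one averages over a family of such sets
  that covers every edge equally often (\<open>forcing_number_le_average\<close>).  The gain is then the total
  weight \<open>2 ^ (n - 1)\<close> times the proportion of edges lying in \<open>S\<close>.  For the hypercube it is enough
  to have star forests with \<open>5 * 2 ^ (n - 3)\<close> of the \<open>n * 2 ^ (n - 1)\<close> edges.

  They come from a star forest with \<open>10\<close> edges in \<open>Q\<^sub>4\<close>.  In \<open>Q\<^sub>3\<close> the two stars at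
  antipodal vertices form a tight set with \<open>6\<close> edges.  A neighbouring copy of \<open>Q\<^sub>3\<close> has the opposite
  bipartition, so its stars are moved by a flip of the first coordinate; to keep the cross edges
  from being tight, the two edges of that direction must be given up, leaving \<open>4\<close>.  Since the fourth
  direction then carries no tight edge, \<open>Q\<^sub>n\<close> can be folded onto \<open>Q\<^sub>4\<close> by keeping three
  coordinates and recording only the parity of the others, and the pullback is again a star forest.
  Translating by the \<open>16\<close> elements of \<open>Q\<^sub>4\<close> makes the edges in each direction equally
  covered, and rotating the three chosen coordinates cyclically makes all directions alike.
\<close>

section \<open>Forcing by potentials\<close>

definition tight_edges :: "'a graph \<Rightarrow> ('a \<Rightarrow> real) \<Rightarrow> 'a set set" where
  "tight_edges G y = {e \<in> edges G. sum y e = 0}"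

text \<open>The second condition gives every tight edge an endpoint of degree one in the tight subgraph, so
  that the tight edges form disjoint stars.\<close>

definition star_forest_potential :: "'a graph \<Rightarrow> ('a \<Rightarrow> real) \<Rightarrow> bool" where
  "star_forest_potential G y \<longleftrightarrow>
     (\<forall>e\<in>edges G. sum y e \<ge> 0) \<and>
     (\<forall>e\<in>tight_edges G y. \<exists>v\<in>e. \<forall>e'\<in>tight_edges G y. v \<in> e' \<longrightarrow> e' = e)"

lemma finite_edges:
  assumes "finite_simple_graph G"
  shows "finite (edges G)"
proof (rule finite_subset)
  show "edges G \<subseteq> Pow (verts G)" "finite (Pow (verts G))"
    using assms by (auto simp: finite_simple_graph_def)
qed

text \<open>With zero vertex sums of \<open>w\<close> this gives the vanishing pairing behind forcing; with \<open>y\<close>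
  constantly one it computes the total weight of a perfect matching.\<close>

lemma sum_edges_vertices_swap:
  fixes w :: "'a set \<Rightarrow> real" and y :: "'a \<Rightarrow> real"
  assumes G: "finite_simple_graph G"
  shows "(\<Sum>e\<in>edges G. w e * sum y e) =
         (\<Sum>v\<in>verts G. y v * (\<Sum>e | e \<in> edges G \<and> v \<in> e. w e))"
proof -
  have fin: "finite (verts G)" "finite (edges G)"
    using G finite_edges[OF G] by (auto simp: finite_simple_graph_def)
  have "(\<Sum>e\<in>edges G. w e * sum y e) =
        (\<Sum>e\<in>edges G. \<Sum>v | v \<in> verts G \<and> v \<in> e. w e * y v)"
  proof (rule sum.cong[OF refl])
    fix e assume "e \<in> edges G"
    then have "{v. v \<in> verts G \<and> v \<in> e} = e"
      using G by (auto simp: finite_simple_graph_def)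
    then show "w e * sum y e = (\<Sum>v | v \<in> verts G \<and> v \<in> e. w e * y v)"
      by (simp add: sum_distrib_left)
  qed
  also have "\<dots> = (\<Sum>v\<in>verts G. \<Sum>e | e \<in> edges G \<and> v \<in> e. w e * y v)"
    by (rule sum.swap_restrict[OF fin(2,1)])
  also have "\<dots> = (\<Sum>v\<in>verts G. y v * (\<Sum>e | e \<in> edges G \<and> v \<in> e. w e))"
    by (simp add: sum_distrib_left mult.commute)
  finally show ?thesis .
qed

lemma total_weight_perfect:
  assumes G: "finite_simple_graph G" and \<gamma>: "\<gamma> \<in> fractional_perfect_matchings G"
  shows "(\<Sum>e\<in>edges G. \<gamma> e) = real (card (verts G)) / 2"
proof -
  have "(\<Sum>e\<in>edges G. \<gamma> e * sum (\<lambda>_. 1) e) = (\<Sum>v\<in>verts G. 1)"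
    using \<gamma> by (simp only: sum_edges_vertices_swap[OF G])
      (simp add: fractional_perfect_matchings_def)
  moreover have "(\<Sum>e\<in>edges G. \<gamma> e * sum (\<lambda>_. 1) e) = (\<Sum>e\<in>edges G. 2 * \<gamma> e)"
    using G by (intro sum.cong) (auto simp: finite_simple_graph_def)
  ultimately show ?thesis
    by (simp add: sum_distrib_left[symmetric])
qed

text \<open>Any competitor \<open>\<gamma>'\<close> differs from \<open>\<gamma>\<close> by some \<open>\<delta>\<close> with zero vertex sums that is nonnegative off
  the tight edges.  So \<open>\<delta> e * sum y e\<close> is nonnegative on each edge and adds up to zero, which kills
  \<open>\<delta>\<close> off the tight edges; the vertex sum at the leaf of a tight edge then kills it there too.\<close>

lemma potential_forces:
  assumes G: "finite_simple_graph G" and \<gamma>: "\<gamma> \<in> fractional_perfect_matchings G"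
    and y: "star_forest_potential G y"
  defines "\<alpha> \<equiv> \<lambda>e\<in>edges G. if e \<in> tight_edges G y then 0 else \<gamma> e"
  shows "forces G \<alpha> \<gamma>"
proof -
  note fin = finite_edges[OF G]
  have \<gamma>_PiE: "\<gamma> \<in> edges G \<rightarrow>\<^sub>E {0..}"
    and \<gamma>_sum: "\<And>v. v \<in> verts G \<Longrightarrow> (\<Sum>e | e \<in> edges G \<and> v \<in> e. \<gamma> e) = 1"
    using \<gamma> by (auto simp: fractional_perfect_matchings_def fractional_matchings_def)
  have \<gamma>_nonneg: "\<gamma> e \<ge> 0" if "e \<in> edges G" for e
    using PiE_mem[OF \<gamma>_PiE that] by simp
  have le: "edge_le G \<alpha> \<gamma>"
    using \<gamma>_nonneg by (auto simp: edge_le_def \<alpha>_def)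
  have "(\<Sum>e | e \<in> edges G \<and> v \<in> e. \<alpha> e) \<le> 1" if "v \<in> verts G" for v
  proof -
    have "(\<Sum>e | e \<in> edges G \<and> v \<in> e. \<alpha> e) \<le> (\<Sum>e | e \<in> edges G \<and> v \<in> e. \<gamma> e)"
      using le by (intro sum_mono) (auto simp: edge_le_def)
    then show ?thesis using \<gamma>_sum[OF that] by simp
  qed
  moreover have "\<alpha> \<in> edges G \<rightarrow>\<^sub>E {0..}"
    using \<gamma>_nonneg by (auto simp: \<alpha>_def)
  ultimately have \<alpha>: "\<alpha> \<in> fractional_matchings G"
    by (simp add: fractional_matchings_def)
  have "\<gamma>' = \<gamma>" if \<gamma>': "\<gamma>' \<in> fractional_perfect_matchings G" and le': "edge_le G \<alpha> \<gamma>'" for \<gamma>'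
  proof -
    define \<delta> where "\<delta> e = \<gamma>' e - \<gamma> e" for e
    have \<gamma>'_PiE: "\<gamma>' \<in> edges G \<rightarrow>\<^sub>E {0..}"
      using \<gamma>' by (auto simp: fractional_perfect_matchings_def fractional_matchings_def)
    have \<delta>_sum: "(\<Sum>e | e \<in> edges G \<and> v \<in> e. \<delta> e) = 0" if "v \<in> verts G" for v
      using \<gamma>_sum[OF that] \<gamma>' that
      by (simp add: \<delta>_def sum_subtractf fractional_perfect_matchings_def)
    have term_nonneg: "\<delta> e * sum y e \<ge> 0" if "e \<in> edges G" for e
    proof (cases "e \<in> tight_edges G y")
      case True
      then show ?thesis by (simp add: tight_edges_def)
    next
      case False
      then have "\<delta> e \<ge> 0"
        using le' that by (auto simp: edge_le_def \<alpha>_def \<delta>_def)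
      moreover have "sum y e \<ge> 0"
        using y that by (simp add: star_forest_potential_def)
      ultimately show ?thesis by simp
    qed
    have "(\<Sum>e\<in>edges G. \<delta> e * sum y e) = 0"
      by (simp add: sum_edges_vertices_swap[OF G] \<delta>_sum)
    then have "\<forall>e\<in>edges G. \<delta> e * sum y e = 0"
      using term_nonneg by (simp add: sum_nonneg_eq_0_iff[OF fin])
    then have off: "\<delta> e = 0" if "e \<in> edges G" "e \<notin> tight_edges G y" for e
      using that by (auto simp: tight_edges_def)
    have on: "\<delta> e = 0" if e: "e \<in> tight_edges G y" for e
    proof -
      obtain v where v: "v \<in> e" "\<And>e'. e' \<in> tight_edges G y \<Longrightarrow> v \<in> e' \<Longrightarrow> e' = e"
        using y e unfolding star_forest_potential_def by meson
      have eG: "e \<in> edges G" using e by (simp add: tight_edges_def)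
      then have "v \<in> verts G" using G v(1) by (auto simp: finite_simple_graph_def)
      then have "0 = (\<Sum>e' | e' \<in> edges G \<and> v \<in> e'. \<delta> e')"
        using \<delta>_sum by simp
      also have "\<dots> = (\<Sum>e'\<in>{e}. \<delta> e')"
      proof (rule sum.mono_neutral_right)
        show "\<forall>e'\<in>{e'. e' \<in> edges G \<and> v \<in> e'} - {e}. \<delta> e' = 0"
          using off v(2) by blast
      qed (use fin eG v(1) in simp_all)
      finally show ?thesis by simp
    qed
    have "\<gamma>' e = \<gamma> e" if "e \<in> edges G" for e
      using on[of e] off[OF that] by (auto simp: \<delta>_def)
    then show ?thesis by (rule PiE_ext[OF \<gamma>'_PiE \<gamma>_PiE])
  qed
  then show ?thesis
    using \<alpha> \<gamma> le unfolding forces_def by blast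
qed

lemma forcing_number_le_potential:
  assumes G: "finite_simple_graph G" and \<gamma>: "\<gamma> \<in> fractional_perfect_matchings G"
    and y: "star_forest_potential G y"
  shows "fractional_forcing_number G \<gamma> \<le>
    real (card (verts G)) / 2 - (\<Sum>e\<in>edges G. of_bool (sum y e = 0) * \<gamma> e)"
proof -
  define \<alpha> where "\<alpha> = (\<lambda>e\<in>edges G. if e \<in> tight_edges G y then 0 else \<gamma> e)"
  have "forces G \<alpha> \<gamma>"
    unfolding \<alpha>_def by (rule potential_forces[OF G \<gamma> y])
  then have "fractional_forcing_number G \<gamma> \<le> l1_norm G \<alpha>"
    unfolding fractional_forcing_number_def
    by (intro cInf_lower bdd_belowI[where m = 0]) (auto simp: l1_norm_def sum_nonneg)
  also have "l1_norm G \<alpha> = (\<Sum>e\<in>edges G. \<gamma> e - of_bool (sum y e = 0) * \<gamma> e)"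
    unfolding l1_norm_def
  proof (rule sum.cong[OF refl])
    fix e assume e: "e \<in> edges G"
    then have "\<gamma> e \<ge> 0"
      using \<gamma> by (auto simp: fractional_perfect_matchings_def fractional_matchings_def)
    then show "\<bar>\<alpha> e\<bar> = \<gamma> e - of_bool (sum y e = 0) * \<gamma> e"
      using e by (simp add: \<alpha>_def tight_edges_def)
  qed
  also have "\<dots> = real (card (verts G)) / 2 - (\<Sum>e\<in>edges G. of_bool (sum y e = 0) * \<gamma> e)"
    by (simp add: sum_subtractf total_weight_perfect[OF G \<gamma>])
  finally show ?thesis .
qed

lemma forcing_number_le_average:
  assumes G: "finite_simple_graph G" and \<gamma>: "\<gamma> \<in> fractional_perfect_matchings G"
    and J: "finite J" "J \<noteq> {}"
    and y: "\<And>j. j \<in> J \<Longrightarrow> star_forest_potential G (y j)"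
    and c: "\<And>e. e \<in> edges G \<Longrightarrow> (\<Sum>j\<in>J. of_bool (sum (y j) e = 0)) = c"
  shows "fractional_forcing_number G \<gamma> \<le>
    real (card (verts G)) / 2 * (1 - c / real (card J))"
proof -
  let ?f = "fractional_forcing_number G \<gamma>" and ?W = "real (card (verts G)) / 2"
  have "real (card J) * ?f \<le>
      (\<Sum>j\<in>J. ?W - (\<Sum>e\<in>edges G. of_bool (sum (y j) e = 0) * \<gamma> e))"
    using sum_mono[OF forcing_number_le_potential[OF G \<gamma> y], of J "\<lambda>j. j"] by simp
  also have "\<dots> = real (card J) * ?W -
      (\<Sum>e\<in>edges G. (\<Sum>j\<in>J. of_bool (sum (y j) e = 0)) * \<gamma> e)"
    by (subst sum_subtractf, subst sum.swap) (simp add: sum_distrib_right)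
  also have "\<dots> = real (card J) * ?W - (\<Sum>e\<in>edges G. c * \<gamma> e)"
    by (simp add: c)
  also have "\<dots> = (real (card J) - c) * ?W"
    by (simp add: sum_distrib_left[symmetric] total_weight_perfect[OF G \<gamma>] algebra_simps)
  finally have "?f \<le> (real (card J) - c) * ?W / real (card J)"
    using J by (simp add: field_simps card_gt_0_iff)
  then show ?thesis
    using J by (simp add: field_simps)
qed

section \<open>A potential on the four-dimensional cube\<close>

type_synonym cube4 = "bool \<times> bool \<times> bool \<times> bool"

text \<open>A direction is a number, and all numbers from \<open>3\<close> on stand for the fourth coordinate.\<close>

fun toggle4 :: "nat \<Rightarrow> cube4 \<Rightarrow> cube4" where
  "toggle4 m (a, b, c, d) = (a \<noteq> (m = 0), b \<noteq> (m = 1), c \<noteq> (m = 2), d \<noteq> (m \<ge> 3))"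

fun shift4 :: "cube4 \<Rightarrow> cube4 \<Rightarrow> cube4" where
  "shift4 (s, t, u, v) (a, b, c, d) = (a \<noteq> s, b \<noteq> t, c \<noteq> u, d \<noteq> v)"

text \<open>The first factor is the sign of the bipartition class, positive on vertices of even parity.  The
  second factor is a height \<open>h\<close>; the edge sums are nonnegative iff \<open>h\<close> never increases along an edge
  from an even to an odd vertex, and an edge is tight iff its ends have the same height.

  In the layer where \<open>d\<close> is false, \<open>h\<close> is \<open>3\<close> on the star around \<open>111\<close> and \<open>-3\<close> on the star around
  \<open>000\<close>.  In the other layer the stars are those around \<open>011\<close> and \<open>100\<close> with the edges in the first
  direction removed, at heights \<open>1\<close> and \<open>-1\<close>, while \<open>111\<close> and \<open>000\<close> are isolated at heights \<open>5\<close> and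
  \<open>-5\<close>.  The values interleave the two layers in such a way that no edge between the layers is
  tight.\<close>

fun potential4 :: "cube4 \<Rightarrow> real" where
  "potential4 (a, b, c, d) =
     (if a = (b = (c = d)) then 1 else -1) *
     (if \<not> d then (if (a \<and> b) \<or> (a \<and> c) \<or> (b \<and> c) then 3 else -3)
      else if a \<and> b \<and> c then 5 else if \<not> a \<and> \<not> b \<and> \<not> c then -5
      else if a then -1 else 1)"

abbreviation tight4 :: "cube4 \<Rightarrow> nat \<Rightarrow> bool" where
  "tight4 z m \<equiv> potential4 z + potential4 (toggle4 m z) = 0"

lemma cube_direction_cases:
  fixes m :: nat
  obtains "m = 0" | "m = Suc 0" | "m = 2" | "m \<ge> 3"
  by linarith

lemma toggle4_shift4: "shift4 s (toggle4 m z) = toggle4 m (shift4 s z)"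
  by (cases s; cases z) auto

lemma potential4_nonneg: "potential4 z + potential4 (toggle4 m z) \<ge> 0"
proof -
  obtain a b c d where "z = (a, b, c, d)" by (cases z)
  then show ?thesis
    by (cases a; cases b; cases c; cases d; cases m rule: cube_direction_cases; simp)
qed

text \<open>This is what allows the fold below to identify all directions but three: an edge in an
  identified direction is never tight.\<close>

lemma tight4_direction: "tight4 z m \<Longrightarrow> m < 3"
proof -
  obtain a b c d where "z = (a, b, c, d)" by (cases z)
  then show "tight4 z m \<Longrightarrow> m < 3"
    by (cases a; cases b; cases c; cases d; cases m rule: cube_direction_cases; simp)
qed

text \<open>One end of a tight edge has no other tight direction.  The star condition is expressed by
  directions rather than edges because in this form it pulls back along the fold.\<close>

lemma tight4_star:
  assumes "tight4 z m"
  shows "(\<forall>m'. tight4 z m' \<longrightarrow> m' = m) \<or> (\<forall>m'. tight4 (toggle4 m z) m' \<longrightarrow> m' = m)"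
proof -
  have all: "(\<forall>m'. tight4 x m' \<longrightarrow> m' = m) \<longleftrightarrow> (\<forall>m'\<in>{0, 1, 2}. tight4 x m' \<longrightarrow> m' = m)" for x
  proof -
    have "m' \<in> {0, 1, 2}" if "tight4 x m'" for m'
      using tight4_direction[OF that] by auto
    then show ?thesis by blast
  qed
  obtain a b c d where "z = (a, b, c, d)" by (cases z)
  then show ?thesis
    using assms tight4_direction[OF assms] unfolding all
    by (cases a; cases b; cases c; cases d; cases m rule: cube_direction_cases; simp)
qed

lemma sum_UNIV_bool: "(\<Sum>a\<in>UNIV. f a) = f False + f True"
  for f :: "bool \<Rightarrow> real"
  by (simp add: UNIV_bool)

lemma sum_UNIV_prod: "(\<Sum>z\<in>UNIV. f z) = (\<Sum>a\<in>UNIV. \<Sum>b\<in>UNIV. f (a, b))"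
  for f :: "'a::finite \<times> 'b::finite \<Rightarrow> real"
  by (simp only: UNIV_Times_UNIV[symmetric] sum.cartesian_product split_def prod.collapse)

lemma sum_shift4:
  fixes f :: "cube4 \<Rightarrow> real"
  shows "(\<Sum>s\<in>UNIV. f (shift4 s z)) = (\<Sum>s\<in>UNIV. f s)"
proof -
  have "shift4 (shift4 s z) z = s" for s
    by (cases s; cases z) auto
  then have "bij (\<lambda>s. shift4 s z)"
    by (intro o_bij[where g = "\<lambda>s. shift4 s z"]) (auto simp: fun_eq_iff)
  then show ?thesis
    by (rule sum.reindex_bij_betw)
qed

text \<open>A tight edge is met by the shifts of a fixed edge in its direction twice, once for each
  orientation.  The ten tight edges are \<open>2\<close> in the first direction, lost in one of the two layers, and
  \<open>4\<close> in each of the next two.\<close>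

lemma tight4_count:
  "(\<Sum>s\<in>UNIV. of_bool (tight4 (shift4 s z) m)) =
     (if m = 0 then 4 else if m < 3 then 8 else 0 :: real)"
proof -
  have "(\<Sum>s\<in>UNIV. of_bool (tight4 (shift4 s z) m) :: real) = (\<Sum>s\<in>UNIV. of_bool (tight4 s m))"
    by (rule sum_shift4)
  also have "\<dots> = (if m = 0 then 4 else if m < 3 then 8 else 0)"
    unfolding sum_UNIV_prod sum_UNIV_bool by (cases m rule: cube_direction_cases; simp)
  finally show ?thesis .
qed

declare toggle4.simps [simp del] shift4.simps [simp del] potential4.simps [simp del]

section \<open>Folding the hypercube onto the four-dimensional cube\<close>

definition flip :: "nat \<Rightarrow> bool list \<Rightarrow> bool list" where
  "flip k u = u[k := \<not> u ! k]"

lemma length_flip [simp]: "length (flip k u) = length u"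
  by (simp add: flip_def)

lemma nth_flip: "j < length u \<Longrightarrow> flip k u ! j = (u ! j \<noteq> (j = k))"
  by (auto simp: flip_def nth_list_update)

lemma flip_flip [simp]: "flip k (flip k u) = u"
  by (cases "k < length u") (auto simp: flip_def list_update_beyond)

lemma flip_neq: "k < length u \<Longrightarrow> flip k u \<noteq> u"
  using nth_flip[of k u k] by auto

lemma verts_hypercube: "verts (hypercube n) = {u. length u = n}"
  by (simp add: hypercube_def)

lemma edges_hypercube:
  "edges (hypercube n) = {{u, flip k u} | u k. length u = n \<and> k < n}"
proof (intro set_eqI iffI)
  fix e assume "e \<in> edges (hypercube n)"
  then obtain u v where uv: "e = {u, v}" "length u = n" "length v = n"
    "card {i. i < n \<and> u ! i \<noteq> v ! i} = 1"
    by (auto simp: hypercube_def)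
  then obtain k where k: "{i. i < n \<and> u ! i \<noteq> v ! i} = {k}"
    by (auto simp: card_1_singleton_iff)
  then have "v = flip k u"
    using uv by (intro nth_equalityI) (auto simp: nth_flip)
  then show "e \<in> {{u, flip k u} | u k. length u = n \<and> k < n}"
    using uv k by blast
next
  fix e assume "e \<in> {{u, flip k u} | u k. length u = n \<and> k < n}"
  then obtain u k where uk: "e = {u, flip k u}" "length u = n" "k < n" by blast
  then have "{i. i < n \<and> u ! i \<noteq> flip k u ! i} = {k}"
    by (auto simp: nth_flip)
  then show "e \<in> edges (hypercube n)"
    unfolding hypercube_def Let_def snd_conv using uk
    by (intro CollectI exI[of _ u] exI[of _ "flip k u"]) simp
qed

lemma edge_at_vertex:
  assumes "e \<in> edges (hypercube n)" "v \<in> e"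
  obtains k where "k < n" "length v = n" "e = {v, flip k v}"
  using assms by (auto simp: edges_hypercube insert_commute)

text \<open>All edges in the direction of the first coordinate form a perfect matching.\<close>

lemma hypercube_has_perfect_matching:
  assumes "n > 0"
  shows "fractional_perfect_matchings (hypercube n) \<noteq> {}"
proof -
  let ?M = "{{u, flip 0 u} | u. length u = n}"
  define \<gamma> :: "bool list set \<Rightarrow> real" where
    "\<gamma> = (\<lambda>e\<in>edges (hypercube n). of_bool (e \<in> ?M))"
  have "(\<Sum>e | e \<in> edges (hypercube n) \<and> v \<in> e. \<gamma> e) = 1" if v: "length v = n" for v
  proof -
    have "(\<Sum>e | e \<in> edges (hypercube n) \<and> v \<in> e. \<gamma> e) = (\<Sum>e\<in>{{v, flip 0 v}}. \<gamma> e)"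
    proof (rule sum.mono_neutral_right)
      show "finite {e. e \<in> edges (hypercube n) \<and> v \<in> e}"
        using finite_edges[OF finite_simple_graph_hypercube] by simp
      show "{{v, flip 0 v}} \<subseteq> {e. e \<in> edges (hypercube n) \<and> v \<in> e}"
        using assms v by (auto simp: edges_hypercube)
      show "\<forall>e\<in>{e. e \<in> edges (hypercube n) \<and> v \<in> e} - {{v, flip 0 v}}. \<gamma> e = 0"
        by (auto simp: \<gamma>_def insert_commute)
    qed
    also have "\<dots> = 1"
      using assms v by (auto simp: \<gamma>_def edges_hypercube)
    finally show ?thesis .
  qed
  then have "\<gamma> \<in> fractional_perfect_matchings (hypercube n)"
    by (auto simp: fractional_perfect_matchings_def fractional_matchings_def verts_hypercube
        \<gamma>_def)
  then show ?thesis by blast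
qed

text \<open>The parity of the remaining coordinates changes along every edge in a direction other than \<open>p\<close>,
  \<open>q\<close>, \<open>r\<close>, so that edges of the hypercube go to edges of the four-dimensional cube.\<close>

fun fold4 :: "nat \<times> nat \<times> nat \<Rightarrow> bool list \<Rightarrow> cube4" where
  "fold4 (p, q, r) u =
     (u ! p, u ! q, u ! r, odd (card {j. j < length u \<and> j \<notin> {p, q, r} \<and> u ! j}))"

fun fold_direction :: "nat \<times> nat \<times> nat \<Rightarrow> nat \<Rightarrow> nat" where
  "fold_direction (p, q, r) k = (if k = p then 0 else if k = q then 1 else if k = r then 2 else 3)"

text \<open>On tight directions nothing is identified, so a vertex of the hypercube has as many tight edges as
  its image.\<close>

lemma fold_direction_inj:
  "fold_direction P k = fold_direction P k' \<Longrightarrow> fold_direction P k < 3 \<Longrightarrow> k = k'"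
  by (cases P) (auto simp: fold_direction.simps split: if_splits)

lemma parity_flip:
  assumes "k < length u"
  shows "odd (card {j. j < length u \<and> j \<in> M \<and> flip k u ! j}) =
         (odd (card {j. j < length u \<and> j \<in> M \<and> u ! j}) \<noteq> (k \<in> M))"
proof -
  let ?A = "{j. j < length u \<and> j \<in> M \<and> j \<noteq> k \<and> u ! j}"
  have "{j. j < length u \<and> j \<in> M \<and> u ! j} = (if k \<in> M \<and> u ! k then insert k ?A else ?A)"
    using assms by auto
  moreover have "{j. j < length u \<and> j \<in> M \<and> flip k u ! j} =
      (if k \<in> M \<and> \<not> u ! k then insert k ?A else ?A)"
    using assms by (auto simp: nth_flip)
  moreover have "card (insert k ?A) = Suc (card ?A)"
    by (intro card_insert_disjoint) auto
  ultimately show ?thesis by auto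
qed

lemma fold4_flip:
  assumes "distinct [p, q, r]" "{p, q, r} \<subseteq> {..<length u}" "k < length u"
  shows "fold4 (p, q, r) (flip k u) =
         toggle4 (fold_direction (p, q, r) k) (fold4 (p, q, r) u)"
  using assms parity_flip[OF assms(3), of "- {p, q, r}"]
  by (auto simp: nth_flip toggle4.simps)

declare fold4.simps [simp del] fold_direction.simps [simp del]

definition cube_potential :: "nat \<times> nat \<times> nat \<Rightarrow> cube4 \<Rightarrow> bool list \<Rightarrow> real" where
  "cube_potential P s u = potential4 (shift4 s (fold4 P u))"

lemma cube_potential_edge:
  assumes "distinct [p, q, r]" "{p, q, r} \<subseteq> {..<length u}" "k < length u"
  shows "sum (cube_potential (p, q, r) s) {u, flip k u} =
    potential4 (shift4 s (fold4 (p, q, r) u)) +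
    potential4 (toggle4 (fold_direction (p, q, r) k) (shift4 s (fold4 (p, q, r) u)))"
  using flip_neq[OF assms(3)]
  by (simp add: cube_potential_def fold4_flip[OF assms] toggle4_shift4)

text \<open>If \<open>k\<close> is the only tight direction at the image of a vertex, then the edge in direction \<open>k\<close> is the
  only tight edge at that vertex, since tight directions have a unique preimage.\<close>

lemma cube_potential_star_forest:
  assumes "distinct [p, q, r]" "{p, q, r} \<subseteq> {..<n}"
  shows "star_forest_potential (hypercube n) (cube_potential (p, q, r) s)"
proof -
  let ?y = "cube_potential (p, q, r) s" and ?dir = "fold_direction (p, q, r)"
  let ?z = "\<lambda>u. shift4 s (fold4 (p, q, r) u)"
  have edge: "sum ?y {u, flip k u} = potential4 (?z u) + potential4 (toggle4 (?dir k) (?z u))"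
    if "length u = n" "k < n" for u k
    using cube_potential_edge[OF assms(1), of u k s] assms(2) that by simp
  have "sum ?y e \<ge> 0" if "e \<in> edges (hypercube n)" for e
  proof -
    obtain u k where uk: "e = {u, flip k u}" "length u = n" "k < n"
      using \<open>e \<in> edges (hypercube n)\<close> by (auto simp: edges_hypercube)
    show ?thesis
      unfolding uk(1) edge[OF uk(2,3)] by (rule potential4_nonneg)
  qed
  moreover have "\<exists>v\<in>e. \<forall>e'\<in>tight_edges (hypercube n) ?y. v \<in> e' \<longrightarrow> e' = e"
    if e: "e \<in> tight_edges (hypercube n) ?y" for e
  proof -
    obtain u k where uk: "e = {u, flip k u}" "length u = n" "k < n"
      using e by (auto simp: tight_edges_def edges_hypercube)
    have tight: "tight4 (?z u) (?dir k)"
      using e edge[OF uk(2,3)] by (simp add: tight_edges_def uk(1))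
    have only_edge: "e' = {v, flip k v}"
      if v: "\<forall>m. tight4 (?z v) m \<longrightarrow> m = ?dir k"
        and e': "e' \<in> tight_edges (hypercube n) ?y" "v \<in> e'" for v e'
    proof -
      have "e' \<in> edges (hypercube n)"
        using e'(1) by (simp add: tight_edges_def)
      then obtain k' where k': "k' < n" "length v = n" "e' = {v, flip k' v}"
        using e'(2) by (rule edge_at_vertex)
      have "tight4 (?z v) (?dir k')"
        using e'(1) edge[OF k'(2,1)] by (simp add: tight_edges_def k'(3))
      then have "?dir k = ?dir k'" using v by simp
      then have "k = k'"
        by (rule fold_direction_inj) (rule tight4_direction[OF tight])
      then show ?thesis using k' by simp
    qed
    have "?z (flip k u) = toggle4 (?dir k) (?z u)"
      using fold4_flip[OF assms(1), of u k] assms(2) uk by (simp only: toggle4_shift4)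
    then consider "\<forall>m. tight4 (?z u) m \<longrightarrow> m = ?dir k"
      | "\<forall>m. tight4 (?z (flip k u)) m \<longrightarrow> m = ?dir k"
      using tight4_star[OF tight] by metis
    then show ?thesis
    proof cases
      case 1
      then show ?thesis using only_edge[OF 1] uk(1) by blast
    next
      case 2
      then show ?thesis using only_edge[OF 2] uk(1) by (auto simp: insert_commute)
    qed
  qed
  ultimately show ?thesis by (simp add: star_forest_potential_def)
qed

section \<open>Averaging over shifts and coordinate triples\<close>

definition coordinate_triple :: "nat \<Rightarrow> nat \<Rightarrow> nat \<times> nat \<times> nat" where
  "coordinate_triple n i = (i, (i + 1) mod n, (i + 2) mod n)"

lemma add_mod_once:
  fixes i m n :: nat
  assumes "i < n" "m < n"
  shows "(i + m) mod n = (if i + m < n then i + m else i + m - n)"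
  using assms by (simp add: mod_if)

lemma coordinate_triple_distinct:
  fixes n i :: nat
  assumes "n \<ge> 3" "i < n"
  shows "distinct [i, (i + 1) mod n, (i + 2) mod n]"
    and "{i, (i + 1) mod n, (i + 2) mod n} \<subseteq> {..<n}"
  using assms by (auto simp: add_mod_once simp del: add_Suc_right One_nat_def add_2_eq_Suc')

lemma sum_cyclic_shift_indicator:
  fixes k m n :: nat
  assumes "k < n" "m < n"
  shows "(\<Sum>i<n. of_bool (k = (i + m) mod n) :: real) = 1"
proof -
  have "{i \<in> {..<n}. k = (i + m) mod n} = {if m \<le> k then k - m else k + n - m}"
    using assms by (auto simp: add_mod_once split: if_splits)
  then show ?thesis
    by (simp add: of_bool_def sum.If_cases Int_def)
qed

text \<open>An edge in direction \<open>k\<close> is first, second and third direction of exactly one cyclic triple each, and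
  is tight for \<open>4\<close>, \<open>8\<close> and \<open>8\<close> shifts in these cases, by \<open>tight4_count\<close>.\<close>

lemma hypercube_tight_count:
  assumes n: "n \<ge> 3" and e: "e \<in> edges (hypercube n)"
  shows "(\<Sum>(i, s)\<in>{..<n} \<times> UNIV.
           of_bool (sum (cube_potential (coordinate_triple n i) s) e = 0)) = (20 :: real)"
proof -
  obtain u k where uk: "e = {u, flip k u}" "length u = n" "k < n"
    using e by (auto simp: edges_hypercube)
  have "(\<Sum>s\<in>UNIV. of_bool (sum (cube_potential (coordinate_triple n i) s) e = 0)) =
      4 * of_bool (k = (i + 0) mod n) + 8 * of_bool (k = (i + 1) mod n) +
      8 * (of_bool (k = (i + 2) mod n) :: real)" if "i < n" for i
  proof -
    note d = coordinate_triple_distinct[OF n that]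
    have "(\<Sum>s\<in>UNIV. of_bool (sum (cube_potential (coordinate_triple n i) s) e = 0) :: real) =
        (\<Sum>s\<in>UNIV. of_bool (tight4 (shift4 s (fold4 (coordinate_triple n i) u))
          (fold_direction (coordinate_triple n i) k)))"
      using cube_potential_edge[OF d(1), of u k] d(2) uk
      by (simp only: coordinate_triple_def)
    also have "\<dots> = (if fold_direction (coordinate_triple n i) k = 0 then 4
        else if fold_direction (coordinate_triple n i) k < 3 then 8 else 0)"
      by (rule tight4_count)
    also have "\<dots> = 4 * of_bool (k = (i + 0) mod n) + 8 * of_bool (k = (i + 1) mod n) +
        8 * (of_bool (k = (i + 2) mod n) :: real)"
      using d(1) that by (auto simp: coordinate_triple_def fold_direction.simps)
    finally show ?thesis .
  qed
  then have "(\<Sum>(i, s)\<in>{..<n} \<times> UNIV.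
           of_bool (sum (cube_potential (coordinate_triple n i) s) e = 0)) =
      (\<Sum>i<n. 4 * of_bool (k = (i + 0) mod n) + 8 * of_bool (k = (i + 1) mod n) +
      8 * (of_bool (k = (i + 2) mod n) :: real))"
    by (simp only: sum.cartesian_product[symmetric]) simp
  also have "\<dots> = 20"
    using n uk(3) sum_cyclic_shift_indicator[of k n]
    by (simp only: sum.distrib sum_distrib_left[symmetric])
  finally show ?thesis .
qed

text \<open>Each edge is tight for \<open>20\<close> of the \<open>16 * n\<close> potentials, and \<open>20 / (16 * n) * 2 ^ (n - 1)\<close> is
  \<open>5 * 2 ^ (n - 3) / n\<close>.\<close>

lemma hypercube_forcing_number_le:
  assumes n: "n \<ge> 3" and \<gamma>: "\<gamma> \<in> fractional_perfect_matchings (hypercube n)"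
  shows "fractional_forcing_number (hypercube n) \<gamma> \<le>
    (real n * 2 ^ (n - 1) - 5 * 2 ^ (n - 3)) / real n"
proof -
  let ?J = "{..<n} \<times> (UNIV :: cube4 set)"
  let ?y = "\<lambda>(i, s). cube_potential (coordinate_triple n i) s"
  have V: "card (verts (hypercube n)) = 2 ^ n"
    using card_lists_length_eq[of "UNIV :: bool set" n] by (simp add: verts_hypercube)
  have J: "card ?J = 16 * n"
    by (simp add: card_cartesian_product card_UNIV_bool
        UNIV_Times_UNIV[symmetric] del: UNIV_Times_UNIV)
  have "fractional_forcing_number (hypercube n) \<gamma> \<le>
      real (card (verts (hypercube n))) / 2 * (1 - 20 / real (card ?J))"
  proof (rule forcing_number_le_average[OF finite_simple_graph_hypercube \<gamma>])
    show "finite ?J" "?J \<noteq> {}"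
      using n by (auto simp: lessThan_empty_iff)
    show "star_forest_potential (hypercube n) (?y j)" if "j \<in> ?J" for j
      using that coordinate_triple_distinct[OF n]
      by (auto simp only: coordinate_triple_def lessThan_iff mem_Sigma_iff split: prod.splits
          intro!: cube_potential_star_forest)
    show "(\<Sum>j\<in>?J. of_bool (sum (?y j) e = 0)) = (20 :: real)"
      if "e \<in> edges (hypercube n)" for e
      using hypercube_tight_count[OF n that] by (simp only: split_def)
  qed
  also have "\<dots> = 2 ^ n / 2 * (1 - 20 / (16 * real n))"
    by (simp add: V J)
  also have "\<dots> = (real n * 2 ^ (n - 1) - 5 * 2 ^ (n - 3)) / real n"
  proof -
    obtain m where "n = m + 3" using n by (metis add.commute le_Suc_ex)
    then show ?thesis by (simp add: field_simps power_add)
  qed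
  finally show ?thesis .
qed

theorem theorem4p4:
  fixes n :: nat
  assumes "n \<ge> 4"
  shows "max_fractional_forcing_number (hypercube n)
           \<le> (real n * 2 ^ (n - 1) - 5 * 2 ^ (n - 3)) / real n"
  unfolding max_fractional_forcing_number_def
  using assms by (intro cSUP_least hypercube_has_perfect_matching hypercube_forcing_number_le) auto

end
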